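(* Let $d\ge2$ and $1\le k<d$ be integers and let $f$ be a probability density on $\mathbb{R}^d$ that is almost everywhere bounded and continuous. For each choice of sign $\pm$, let $\mathcal{V}_k^{\pm}(t)=\int_{\mathbb{R}^{d(k+1)}}h_t^{\pm}(0,\mathbf{y})\,M_k(d\mathbf{y})$, $t\ge0$. Then $$\big(\mathcal{V}_k^{\pm}(t),\ t\ge0\big)\overset{d}{=}\Big(N_k^{\pm}\big(t^{d(k+1)}\big),\ t\ge0\Big),$$ where $N_k^{\pm}$ is a homogeneous Poisson process on $[0,\infty)$ with intensity $C_{f,k}\,m_k(D_1^{\pm})$ and $D_t^{\pm}=\{\mathbf{y}\in\mathbb{R}^{d(k+1)}:h_t^{\pm}(0,\mathbf{y})=1\}$.
   Context: Notation. $B(x;r)=\{y\in\mathbb{R}^d:|x-y|<r\}$. For $x_1,\dots,x_{k+2}\in\mathbb{R}^d$ and $t\ge0$, $$h_t^+(x_1,\dots,x_{k+2})=\prod_{i=1}^{k+2}\mathbf{1}\Big\{\bigcap_{j=1,\,j\ne i}^{k+2}B(x_j;t/2)\neq\emptyset\Big\},\qquad h_t^-(x_1,\dots,x_{k+2})=\mathbf{1}\Big\{\bigcap_{j=1}^{k+2}B(x_j;t/2)\ne\emptyset\Big\}.$$ For $\mathbf{y}=(y_1,\dots,y_{k+1})\in\mathbb{R}^{d(k+1)}$, $h_t^\pm(0,\mathbf{y})=h_t^\pm(0,y_1,\dots,y_{k+1})$. $m_k$ denotes Lebesgue measure on $\mathbb{R}^{d(k+1)}$ and $C_{f,k}=\frac{1}{(k+2)!}\int_{\mathbb{R}^d}f(x)^{k+2}\,dx$.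 $M_k$ is a Poisson random measure on $\mathbb{R}^{d(k+1)}$ with mean measure $C_{f,k}m_k$: $M_k(A)\sim\mathrm{Poi}(C_{f,k}m_k(A))$ for measurable $A$, with $M_k(A_1),\dots,M_k(A_m)$ independent for disjoint $A_1,\dots,A_m$. $\overset{d}{=}$ denotes equality of finite-dimensional distributions. *)

theory Defs
  imports "HOL-Probability.Probability"
begin

(* The library's poisson_pmf is specified only for positive rates; Poi(0) is the point mass at 0. *)
definition poisson_law :: "real \<Rightarrow> nat pmf" where
  "poisson_law r = (if r > 0 then poisson_pmf r else return_pmf 0)"

(* Random measures are families M w of measures, indexed by the points w of the probability
   space P.  On a set of infinite mean measure the Poisson law is the point mass at infinity. *)
definition poisson_random_measure :: "'w measure \<Rightarrow> 'a measure \<Rightarrow> ('w \<Rightarrow> 'a measure) \<Rightarrow> bool" where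
  "poisson_random_measure P \<mu> M \<longleftrightarrow>
     prob_space P \<and>
     (\<forall>\<omega>\<in>space P. sets (M \<omega>) = sets \<mu>) \<and>
     (\<forall>A\<in>sets \<mu>. (\<lambda>\<omega>. emeasure (M \<omega>) A) \<in> borel_measurable P) \<and>
     (\<forall>A\<in>sets \<mu>. emeasure \<mu> A < \<infinity> \<longrightarrow>
        distr P borel (\<lambda>\<omega>. emeasure (M \<omega>) A) =
        distr (measure_pmf (poisson_law (measure \<mu> A))) borel (of_nat :: nat \<Rightarrow> ennreal)) \<and>
     (\<forall>A\<in>sets \<mu>. emeasure \<mu> A = \<infinity> \<longrightarrow> (AE \<omega> in P. emeasure (M \<omega>) A = \<infinity>)) \<and>
     (\<forall>(n::nat) A. A ` {..<n} \<subseteq> sets \<mu> \<longrightarrow> disjoint_family_on A {..<n} \<longrightarrow>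
        prob_space.indep_vars P (\<lambda>_. borel) (\<lambda>i \<omega>. emeasure (M \<omega>) (A i)) {..<n})"

(* Since the paths are almost surely nondecreasing, the truncated subtraction of natural numbers
   gives the genuine increments almost surely. *)
definition homogeneous_poisson_process :: "'w measure \<Rightarrow> real \<Rightarrow> (real \<Rightarrow> 'w \<Rightarrow> nat) \<Rightarrow> bool" where
  "homogeneous_poisson_process P r N \<longleftrightarrow>
     prob_space P \<and>
     (\<forall>t\<ge>0. N t \<in> measurable P (count_space UNIV)) \<and>
     (AE \<omega> in P. N 0 \<omega> = 0 \<and> mono_on {0..} (\<lambda>t. N t \<omega>) \<and>
        (\<forall>t\<ge>0. continuous (at_right t) (\<lambda>s. real (N s \<omega>)))) \<and>
     (\<forall>s t. 0 \<le> s \<longrightarrow> s \<le> t \<longrightarrow>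
        distr P (count_space UNIV) (\<lambda>\<omega>. N t \<omega> - N s \<omega>) = measure_pmf (poisson_law (r * (t - s)))) \<and>
     (\<forall>(n::nat) \<tau>. 0 \<le> \<tau> 0 \<longrightarrow> (\<forall>i<n. \<tau> i \<le> \<tau> (Suc i)) \<longrightarrow>
        prob_space.indep_vars P (\<lambda>_. count_space UNIV)
          (\<lambda>i \<omega>. N (\<tau> (Suc i)) \<omega> - N (\<tau> i) \<omega>) {..<n})"

definition equal_fdd :: "'i set \<Rightarrow> 'b measure \<Rightarrow> 'w measure \<Rightarrow> ('i \<Rightarrow> 'w \<Rightarrow> 'b) \<Rightarrow>
    'v measure \<Rightarrow> ('i \<Rightarrow> 'v \<Rightarrow> 'b) \<Rightarrow> bool" where
  "equal_fdd T S P X Q Y \<longleftrightarrow>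
     (\<forall>t\<in>T. X t \<in> measurable P S \<and> Y t \<in> measurable Q S) \<and>
     (\<forall>J\<subseteq>T. finite J \<longrightarrow>
        distr P (PiM J (\<lambda>_. S)) (\<lambda>\<omega>. \<lambda>t\<in>J. X t \<omega>) =
        distr Q (PiM J (\<lambda>_. S)) (\<lambda>\<omega>. \<lambda>t\<in>J. Y t \<omega>))"

datatype sign = Plus | Minus

(* The points x_1, ..., x_{k+2} are x 0, ..., x (k+1).  For t = 0 the balls are empty. *)
fun h :: "sign \<Rightarrow> nat \<Rightarrow> real \<Rightarrow> (nat \<Rightarrow> real ^ 'd) \<Rightarrow> real" where
  "h Plus k t x = (\<Prod>i<k+2. of_bool ((\<Inter>j\<in>{..<k+2} - {i}. ball (x j) (t/2)) \<noteq> {}))"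
| "h Minus k t x = of_bool ((\<Inter>j<k+2. ball (x j) (t/2)) \<noteq> {})"

(* Lebesgue measure on the (k+1)-fold power of R^d, whose points (y_1, ..., y_{k+1}) are the
   functions y on {..<k+1}, extended by undefined.  The point configuration (0, y_1, ..., y_{k+1})
   is then case_nat 0 y. *)
definition m :: "nat \<Rightarrow> (nat \<Rightarrow> real ^ 'd) measure" where
  "m k = PiM {..<k+1} (\<lambda>_. lborel)"

definition C :: "(real ^ 'd \<Rightarrow> real) \<Rightarrow> nat \<Rightarrow> real" where
  "C f k = 1 / fact (k + 2) * (\<integral>x. f x ^ (k + 2) \<partial>lborel)"

definition V :: "sign \<Rightarrow> nat \<Rightarrow> ('w \<Rightarrow> (nat \<Rightarrow> real ^ 'd) measure) \<Rightarrow> real \<Rightarrow> 'w \<Rightarrow> ennreal" where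
  "V s k M t \<omega> = (\<integral>\<^sup>+y. ennreal (h s k t (case_nat 0 y)) \<partial>M \<omega>)"

definition D :: "sign \<Rightarrow> nat \<Rightarrow> real \<Rightarrow> (nat \<Rightarrow> real ^ 'd) set" where
  "D s k t = {y \<in> space (m k). h s k t (case_nat 0 y) = 1}"

end

theory Submission
  imports Defs
begin

text \<open>
  Since \<open>h\<close> is an indicator, \<open>V\<^sub>t = M(D\<^sub>t)\<close>, and the sets \<open>D\<^sub>t\<close> increase with \<open>t\<close>, start from \<open>D\<^sub>0 = \<emptyset>\<close> and satisfy
  \<open>D\<^sub>t = t D\<^sub>1\<close> for \<open>t > 0\<close>, so that \<open>m(D\<^sub>t) = t\<^bsup>d(k+1)\<^esup> m(D\<^sub>1)\<close>. For \<open>k \<ge> 1\<close> any two of the \<open>k + 2\<close> points belong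
  to a common face, hence \<open>D\<^sub>t\<close> is bounded and has finite measure. The increments of \<open>V\<close> along a finite
  set of times are the masses of disjoint sets, thus independent Poisson variables with the same
  laws as the increments of the time-changed Poisson process. The finite-dimensional distributions
  are the images of the joint laws of the increments under partial summation.
\<close>

section \<open>Laws of partial sums\<close>

text \<open>Independence makes the joint law the product of the marginals, so it depends only on
  them, even across different probability spaces. The library characterization used here asks for a
  nonempty index set.\<close>

lemma distr_indep_vars_eq:
  assumes P: "prob_space P" and Q: "prob_space Q" and "I \<noteq> {}"
    and X: "prob_space.indep_vars P S X I" and Y: "prob_space.indep_vars Q S Y I"
    and law: "\<And>i. i \<in> I \<Longrightarrow> distr P (S i) (X i) = distr Q (S i) (Y i)"
  shows "distr P (PiM I S) (\<lambda>\<omega>. \<lambda>i\<in>I. X i \<omega>) = distr Q (PiM I S) (\<lambda>\<omega>. \<lambda>i\<in>I. Y i \<omega>)"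
proof -
  interpret P: prob_space P by fact
  interpret Q: prob_space Q by fact
  have "\<And>i. i \<in> I \<Longrightarrow> X i \<in> measurable P (S i)" "\<And>i. i \<in> I \<Longrightarrow> Y i \<in> measurable Q (S i)"
    using X Y unfolding P.indep_vars_def Q.indep_vars_def by auto
  then have "distr P (PiM I S) (\<lambda>\<omega>. \<lambda>i\<in>I. X i \<omega>) = (\<Pi>\<^sub>M i\<in>I. distr P (S i) (X i))"
    and "distr Q (PiM I S) (\<lambda>\<omega>. \<lambda>i\<in>I. Y i \<omega>) = (\<Pi>\<^sub>M i\<in>I. distr Q (S i) (Y i))"
    using X Y P.indep_vars_iff_distr_eq_PiM'[OF \<open>I \<noteq> {}\<close>, of X S]
      Q.indep_vars_iff_distr_eq_PiM'[OF \<open>I \<noteq> {}\<close>, of Y S] by auto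
  then show ?thesis
    using law by (simp cong: PiM_cong)
qed

text \<open>The partial-sum map on the right depends only on \<open>ix\<close> and \<open>J\<close>,
  not on the probability space. Two processes with equally distributed increment vectors therefore
  have the same law on \<open>J\<close>. An almost sure identity suffices, which matters for Poisson
  paths that are monotone only almost surely.\<close>

lemma distr_partial_sums:
  fixes X :: "nat \<Rightarrow> 'w \<Rightarrow> 'b :: {second_countable_topology, topological_comm_monoid_add}"
  assumes X: "\<And>i. i < n \<Longrightarrow> X i \<in> borel_measurable P"
    and Z: "\<And>t. t \<in> J \<Longrightarrow> Z t \<in> borel_measurable P"
    and ix: "\<And>t. t \<in> J \<Longrightarrow> ix t \<le> n"
    and sums: "AE \<omega> in P. \<forall>t\<in>J. Z t \<omega> = (\<Sum>i<ix t. X i \<omega>)"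
  shows "distr P (PiM J (\<lambda>_. borel)) (\<lambda>\<omega>. \<lambda>t\<in>J. Z t \<omega>) =
    distr (distr P (PiM {..<n} (\<lambda>_. borel)) (\<lambda>\<omega>. \<lambda>i\<in>{..<n}. X i \<omega>)) (PiM J (\<lambda>_. borel))
      (\<lambda>x. \<lambda>t\<in>J. \<Sum>i<ix t. x i)"
proof -
  have G: "(\<lambda>x. \<lambda>t\<in>J. \<Sum>i<ix t. x i) \<in>
      measurable (PiM {..<n} (\<lambda>_. borel :: 'b measure)) (PiM J (\<lambda>_. borel))"
    using ix by (intro measurable_restrict borel_measurable_sum measurable_component_singleton)
      fastforce
  have H: "(\<lambda>\<omega>. \<lambda>i\<in>{..<n}. X i \<omega>) \<in> measurable P (PiM {..<n} (\<lambda>_. borel))"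
    using X by (intro measurable_restrict) auto
  have "distr P (PiM J (\<lambda>_. borel)) (\<lambda>\<omega>. \<lambda>t\<in>J. Z t \<omega>) =
      distr P (PiM J (\<lambda>_. borel))
        ((\<lambda>x. \<lambda>t\<in>J. \<Sum>i<ix t. x i) \<circ> (\<lambda>\<omega>. \<lambda>i\<in>{..<n}. X i \<omega>))"
  proof (rule distr_cong_AE)
    show "AE \<omega> in P. (\<lambda>t\<in>J. Z t \<omega>) =
        ((\<lambda>x. \<lambda>t\<in>J. \<Sum>i<ix t. x i) \<circ> (\<lambda>\<omega>. \<lambda>i\<in>{..<n}. X i \<omega>)) \<omega>"
      using sums
    proof eventually_elim
      case (elim \<omega>)
      show ?case
      proof
        fix t
        show "(\<lambda>t\<in>J. Z t \<omega>) t =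
            ((\<lambda>x. \<lambda>t\<in>J. \<Sum>i<ix t. x i) \<circ> (\<lambda>\<omega>. \<lambda>i\<in>{..<n}. X i \<omega>)) \<omega> t"
        proof (cases "t \<in> J")
          case True
          then have "(\<Sum>i<ix t. (\<lambda>i\<in>{..<n}. X i \<omega>) i) = (\<Sum>i<ix t. X i \<omega>)"
            using ix[of t] by (intro sum.cong) auto
          then show ?thesis using elim True by simp
        qed simp
      qed
    qed
    show "(\<lambda>\<omega>. \<lambda>t\<in>J. Z t \<omega>) \<in> measurable P (PiM J (\<lambda>_. borel))"
      using Z by (intro measurable_restrict) auto
  qed (use G H in \<open>auto intro: measurable_comp\<close>)
  then show ?thesis
    using distr_distr[OF G H] by simp
qed

lemma finite_subset_range_mono:
  fixes J :: "'a :: linorder set"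
  assumes "finite J" and "\<And>t. t \<in> J \<Longrightarrow> a \<le> t"
  obtains n and \<sigma> :: "nat \<Rightarrow> 'a" where "n > 0" "\<sigma> 0 = a" "mono \<sigma>" "J \<subseteq> \<sigma> ` {..n}"
proof -
  define L where "L = sorted_list_of_set (insert a J)"
  have L: "sorted L" "set L = insert a J"
    using assms(1) by (simp_all add: L_def del: sorted_list_of_set_insert_remove)
  then have ne: "length L > 0" by (metis length_greater_0_conv insert_not_empty set_empty)
  \<comment> \<open>The minimum freezes the sequence at the last list entry, so that it is total and
    still monotone.\<close>
  define \<sigma> where "\<sigma> i = L ! min i (length L - 1)" for i
  have mono: "mono \<sigma>"
    unfolding \<sigma>_def using ne by (intro monoI sorted_nth_mono[OF L(1)]) (auto simp: min_less_iff_disj)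
  have J: "insert a J \<subseteq> \<sigma> ` {..length L}"
  proof
    fix t assume "t \<in> insert a J"
    then obtain i where "i < length L" "L ! i = t" using L(2) by (metis in_set_conv_nth)
    moreover from this have "min i (length L - 1) = i" by simp
    ultimately have "\<sigma> i = t" by (simp only: \<sigma>_def)
    then show "t \<in> \<sigma> ` {..length L}" using \<open>i < length L\<close> by auto
  qed
  have "\<sigma> 0 \<in> insert a J" unfolding \<sigma>_def L(2)[symmetric] using ne by (intro nth_mem) simp
  then have "a \<le> \<sigma> 0" using assms(2) by auto
  moreover have "\<sigma> 0 \<le> a"
  proof -
    obtain i where "a = \<sigma> i" using J by blast
    then show ?thesis using monoD[OF mono, of 0 i] by simp
  qed
  ultimately have "\<sigma> 0 = a" by simp
  \<comment> \<open>Taking \<open>length L\<close> instead of \<open>length L - 1\<close> keeps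
    \<open>n\<close> positive even when \<open>J\<close> has no point besides \<open>a\<close>; the
    repeated last value only adds a trivial increment.\<close>
  then show thesis using that[of "length L" \<sigma>] ne mono J by simp
qed

section \<open>The sets \<open>D\<^sub>t\<close>\<close>

text \<open>A common form for both signs: \<open>h\<close> tests whether these faces lie in the Cech
  complex of balls of radius \<open>t/2\<close>. They are the facets of the simplex on
  \<open>k + 2\<close> vertices for \<open>Plus\<close>, and the simplex itself for
  \<open>Minus\<close>.\<close>

definition faces :: "sign \<Rightarrow> nat \<Rightarrow> nat set set" where
  "faces s k = (case s of Plus \<Rightarrow> (\<lambda>i. {..<k+2} - {i}) ` {..<k+2} | Minus \<Rightarrow> {{..<k+2}})"

lemma h_eq: "h s k t x = of_bool (\<forall>S\<in>faces s k. (\<Inter>j\<in>S. ball (x j) (t/2)) \<noteq> {})"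
proof (cases s)
  case Plus
  have "(\<Prod>i<n. of_bool (R i) :: real) = of_bool (\<forall>i<n. R i)" for R and n :: nat
    by (induction n) (auto simp: less_Suc_eq)
  then show ?thesis using Plus by (auto simp: faces_def)
qed (simp add: faces_def)

lemma D_eq:
  "D s k t = {y \<in> space (m k). \<forall>S\<in>faces s k. (\<Inter>j\<in>S. ball (case_nat 0 y j) (t/2)) \<noteq> {}}"
  by (simp add: D_def h_eq)

lemma finite_faces: "finite (faces s k)"
  by (cases s) (auto simp: faces_def)

lemma faces_subset: "S \<in> faces s k \<Longrightarrow> S \<subseteq> {..<k+2}"
  by (cases s) (auto simp: faces_def)

text \<open>Since \<open>k + 2\<close> is at least 3, some vertex differs from both 0 and
  \<open>j\<close>, and the facet opposite to it contains both. This ties every point of a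
  configuration to the origin.\<close>

lemma ex_face:
  assumes "1 \<le> k" and "j < k + 2"
  obtains S where "S \<in> faces s k" "0 \<in> S" "j \<in> S"
proof (cases s)
  case Plus
  define i where "i = (if j = 1 then 2 else 1 :: nat)"
  then have "i < k + 2" "i \<noteq> 0" "i \<noteq> j" using assms by auto
  then show ?thesis using that[of "{..<k+2} - {i}"] Plus assms by (auto simp: faces_def)
qed (use that[of "{..<k+2}"] assms in \<open>auto simp: faces_def\<close>)

lemma D_mono: "t \<le> u \<Longrightarrow> D s k t \<subseteq> (D s k u :: (nat \<Rightarrow> real ^ 'd) set)"
proof -
  assume "t \<le> u"
  then have "(\<Inter>j\<in>S. ball (x j) (t/2)) \<subseteq> (\<Inter>j\<in>S. ball (x j) (u/2))"
    for S and x :: "nat \<Rightarrow> real ^ 'd"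
    by (intro INT_anti_mono[OF order_refl] subset_ball) simp
  then show ?thesis unfolding D_eq by blast
qed

lemma D_zero:
  assumes "1 \<le> k" shows "(D s k 0 :: (nat \<Rightarrow> real ^ 'd) set) = {}"
proof -
  \<comment> \<open>A nonempty face is essential here: an intersection over no index would be the
    whole space.\<close>
  obtain S where "S \<in> faces s k" "0 \<in> S" using ex_face[OF assms, of 0] by auto
  then have "(\<Inter>j\<in>S. ball (case_nat 0 y j :: real ^ 'd) (0/2)) = {}" for y by auto
  then show ?thesis using \<open>S \<in> faces s k\<close> unfolding D_eq by blast
qed

section \<open>Measurability and finite measure of \<open>D\<close>\<close>

text \<open>A finite intersection of open balls is open, so if nonempty it meets a countable dense
  set. The existential over all centres \<open>p\<close> thus becomes a countable union of
  measurable sets.\<close>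

lemma sets_D: "(D s k t :: (nat \<Rightarrow> real ^ 'd) set) \<in> sets (m k)"
proof -
  obtain Z :: "(real ^ 'd) set" where Z: "countable Z"
    "\<And>X. open X \<Longrightarrow> X \<noteq> {} \<Longrightarrow> \<exists>d\<in>Z. d \<in> X"
    by (rule countable_dense_setE) blast
  have "{y \<in> space (m k). (\<Inter>j\<in>S. ball (case_nat 0 y j) (t/2)) \<noteq> {}} \<in>
      sets (m k :: (nat \<Rightarrow> real ^ 'd) measure)" if S: "S \<in> faces s k" for S
  proof -
    have fin: "finite S" using faces_subset[OF S] by (rule finite_subset) simp
    have "(\<lambda>y. case_nat 0 y j :: real ^ 'd) \<in> borel_measurable (m k)" if "j \<in> S" for j
      using faces_subset[OF S] that unfolding m_def by (cases j) auto
    then have "{y \<in> space (m k). \<forall>j\<in>S. dist (case_nat 0 y j) p < t/2} \<in> sets (m k)"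
      for p :: "real ^ 'd"
      using fin by measurable
    then have "(\<Union>p\<in>Z. {y \<in> space (m k). \<forall>j\<in>S. dist (case_nat 0 y j) p < t/2}) \<in> sets (m k)"
      using Z(1) by (intro sets.countable_UN') auto
    also have "(\<Union>p\<in>Z. {y \<in> space (m k). \<forall>j\<in>S. dist (case_nat 0 y j) p < t/2}) =
        {y \<in> space (m k). (\<Inter>j\<in>S. ball (case_nat 0 y j) (t/2)) \<noteq> {}}"
    proof -
      have "(\<exists>p\<in>Z. \<forall>j\<in>S. dist (x j) p < t/2) \<longleftrightarrow> (\<Inter>j\<in>S. ball (x j) (t/2)) \<noteq> {}"
        for x :: "nat \<Rightarrow> real ^ 'd"
        using Z(2)[of "\<Inter>j\<in>S. ball (x j) (t/2)"] fin by (fastforce intro: open_INT)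
      then show ?thesis by auto
    qed
    finally show ?thesis .
  qed
  then have "{y \<in> space (m k). \<forall>S\<in>faces s k. (\<Inter>j\<in>S. ball (case_nat 0 y j) (t/2)) \<noteq> {}} \<in>
      sets (m k :: (nat \<Rightarrow> real ^ 'd) measure)"
    using finite_faces by (intro sets.sets_Collect_finite_All)
  then show ?thesis by (simp add: D_eq)
qed

interpretation lborel_prod: product_sigma_finite "\<lambda>_. lborel"
  by standard

text \<open>Each \<open>y i\<close> shares a face with the origin, so their balls of radius
  \<open>t/2\<close> meet and \<open>y i\<close> lies within \<open>t\<close> of 0. Hence
  \<open>D\<close> sits inside a product of balls.\<close>

lemma emeasure_D_finite:
  assumes "1 \<le> k"
  shows "emeasure (m k) (D s k t :: (nat \<Rightarrow> real ^ 'd) set) < \<infinity>"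
proof -
  have "D s k t \<subseteq> PiE {..<k+1} (\<lambda>_. ball (0 :: real ^ 'd) t)"
  proof
    fix y :: "nat \<Rightarrow> real ^ 'd" assume y: "y \<in> D s k t"
    have "dist 0 (y i) < t" if i: "i < k + 1" for i
    proof -
      \<comment> \<open>The shift arises because vertex 0 is the origin and vertex
        \<open>Suc i\<close> is \<open>y i\<close>.\<close>
      obtain S where S: "S \<in> faces s k" "0 \<in> S" "Suc i \<in> S"
        using ex_face[OF assms, of "Suc i"] i by auto
      then obtain p where "\<And>j. j \<in> S \<Longrightarrow> p \<in> ball (case_nat 0 y j) (t/2)"
        using y unfolding D_eq by blast
      from this[OF S(2)] this[OF S(3)] show ?thesis
        using dist_triangle_half_l[of 0 p t "y i"] by (simp add: dist_commute)
    qed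
    then show "y \<in> PiE {..<k+1} (\<lambda>_. ball 0 t)"
      using y by (auto simp: D_def m_def space_PiM PiE_iff)
  qed
  then have "emeasure (m k) (D s k t :: (nat \<Rightarrow> real ^ 'd) set) \<le>
      emeasure (m k) (PiE {..<k+1} (\<lambda>_. ball (0 :: real ^ 'd) t))"
    by (rule emeasure_mono) (auto simp: m_def intro!: sets_PiM_I_finite)
  also have "\<dots> = emeasure lborel (ball (0 :: real ^ 'd) t) ^ (k + 1)"
    unfolding m_def by (subst lborel_prod.emeasure_PiM) auto
  also have "\<dots> < \<infinity>"
    using emeasure_lborel_ball_finite[of "0 :: real ^ 'd" t] by (simp add: power_less_top_ennreal ennreal_mult_less_top)
  finally show ?thesis .
qed

section \<open>Dilations and Lebesgue measure\<close>

lemma emeasure_lborel_vimage_scaleR: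
  fixes A :: "'a :: euclidean_space set"
  assumes "t > 0" and "A \<in> sets borel"
  shows "emeasure lborel A = ennreal (t ^ DIM('a)) * emeasure lborel ((\<lambda>x. t *\<^sub>R x) -` A)"
proof -
  have "emeasure lborel A =
      emeasure (density (distr lborel borel (\<lambda>x. 0 + t *\<^sub>R x)) (\<lambda>_. \<bar>t\<bar> ^ DIM('a))) A"
    using lborel_affine[of t "0 :: 'a"] assms(1) by simp
  also have "\<dots> = ennreal (t ^ DIM('a)) * emeasure lborel ((\<lambda>x. t *\<^sub>R x) -` A)"
    using assms by (simp add: emeasure_density_const emeasure_distr)
  finally show ?thesis .
qed

text \<open>The product measure is determined by its values on boxes, and on a box the dilation acts
  factor by factor, each factor contributing \<open>t ^ DIM('a)\<close>.\<close>

lemma PiM_lborel_scaleR: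
  fixes I :: "'i set"
  assumes "finite I" and "t > 0"
  shows "(PiM I (\<lambda>_. lborel :: 'a :: euclidean_space measure)) =
    scale_measure (ennreal (t ^ (DIM('a) * card I)))
      (distr (PiM I (\<lambda>_. lborel)) (PiM I (\<lambda>_. lborel)) (\<lambda>y. \<lambda>i\<in>I. t *\<^sub>R y i))"
proof (rule lborel_prod.PiM_eqI[symmetric, OF assms(1)])
  fix A :: "'i \<Rightarrow> 'a set"
  assume "\<And>i. i \<in> I \<Longrightarrow> A i \<in> sets lborel"
  then have A: "\<And>i. i \<in> I \<Longrightarrow> A i \<in> sets borel" by simp
  have B: "(\<lambda>x. t *\<^sub>R x) -` A i \<in> sets borel" if "i \<in> I" for i
    using measurable_sets[OF _ A[OF that], of "\<lambda>x. t *\<^sub>R x" borel] by simp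
  have T: "(\<lambda>y. \<lambda>i\<in>I. t *\<^sub>R y i) \<in>
      measurable (PiM I (\<lambda>_. lborel :: 'a measure)) (PiM I (\<lambda>_. lborel))"
    by (intro measurable_restrict) simp
  have "(\<lambda>y. \<lambda>i\<in>I. t *\<^sub>R y i) -` PiE I A \<inter> space (PiM I (\<lambda>_. lborel)) =
      PiE I (\<lambda>i. (\<lambda>x. t *\<^sub>R x) -` A i)"
    by (auto simp: space_PiM PiE_iff)
  then have "emeasure (distr (PiM I (\<lambda>_. lborel)) (PiM I (\<lambda>_. lborel)) (\<lambda>y. \<lambda>i\<in>I. t *\<^sub>R y i)) (PiE I A)
      = (\<Prod>i\<in>I. emeasure lborel ((\<lambda>x. t *\<^sub>R x) -` A i))"
    using A B assms(1) by (simp add: emeasure_distr[OF T] lborel_prod.emeasure_PiM)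
  moreover have "(\<Prod>i\<in>I. emeasure lborel (A i)) =
      (\<Prod>i\<in>I. ennreal (t ^ DIM('a)) * emeasure lborel ((\<lambda>x. t *\<^sub>R x) -` A i))"
    using A emeasure_lborel_vimage_scaleR[OF assms(2)] by (intro prod.cong) auto
  ultimately show "emeasure (scale_measure (ennreal (t ^ (DIM('a) * card I)))
      (distr (PiM I (\<lambda>_. lborel)) (PiM I (\<lambda>_. lborel)) (\<lambda>y. \<lambda>i\<in>I. t *\<^sub>R y i))) (PiE I A) =
      (\<Prod>i\<in>I. emeasure lborel (A i))"
    using assms(2) by (simp add: prod.distrib power_mult ennreal_power)
qed simp

text \<open>The dilation fixes the origin and carries balls of radius \<open>1/2\<close> onto balls
  of radius \<open>t/2\<close>, so each intersection for the dilated configuration is the dilated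
  intersection.\<close>

lemma scaleR_mem_D_iff:
  fixes y :: "nat \<Rightarrow> real ^ 'd"
  assumes "t > 0" and "y \<in> space (m k)"
  shows "(\<lambda>i\<in>{..<k+1}. t *\<^sub>R y i) \<in> D s k t \<longleftrightarrow> y \<in> D s k 1"
proof -
  let ?T = "\<lambda>i\<in>{..<k+1}. t *\<^sub>R y i"
  have dist: "dist (t *\<^sub>R a) (t *\<^sub>R b) = t * dist a b" for a b :: "real ^ 'd"
    using assms(1) by (simp add: dist_norm flip: scaleR_diff_right)
  have "(\<Inter>j\<in>S. ball (case_nat 0 ?T j) (t/2)) \<noteq> {} \<longleftrightarrow>
      (\<Inter>j\<in>S. ball (case_nat 0 y j) (1/2)) \<noteq> {}" if S: "S \<in> faces s k" for S
  proof -
    have "case_nat 0 ?T j = t *\<^sub>R case_nat 0 y j" if "j \<in> S" for j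
      using faces_subset[OF S] that by (cases j) auto
    then have "(\<Inter>j\<in>S. ball (case_nat 0 ?T j) (t/2)) =
        (\<Inter>j\<in>S. ball (t *\<^sub>R case_nat 0 y j) (t * (1/2)))"
      by simp
    also have "\<dots> = (\<lambda>x. t *\<^sub>R x) ` (\<Inter>j\<in>S. ball (case_nat 0 y j) (1/2))"
    proof (intro set_eqI iffI)
      fix p assume p: "p \<in> (\<Inter>j\<in>S. ball (t *\<^sub>R case_nat 0 y j) (t * (1/2)))"
      have "inverse t *\<^sub>R p \<in> ball (case_nat 0 y j) (1/2)" if "j \<in> S" for j
      proof -
        have "dist (t *\<^sub>R case_nat 0 y j) (t *\<^sub>R (inverse t *\<^sub>R p)) < t * (1/2)"
          using p that assms(1) by auto
        then show ?thesis using assms(1) unfolding dist by simp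
      qed
      then show "p \<in> (\<lambda>x. t *\<^sub>R x) ` (\<Inter>j\<in>S. ball (case_nat 0 y j) (1/2))"
        using assms(1) by (intro image_eqI[of _ _ "inverse t *\<^sub>R p"]) auto
    qed (use assms(1) in \<open>auto simp: dist\<close>)
    finally show ?thesis by simp
  qed
  moreover have "?T \<in> space (m k)" by (auto simp: m_def space_PiM)
  ultimately show ?thesis using assms(2) unfolding D_eq mem_Collect_eq by blast
qed

lemma emeasure_D:
  assumes "1 \<le> k" and "0 \<le> t"
  shows "emeasure (m k) (D s k t :: (nat \<Rightarrow> real ^ 'd) set) =
    ennreal (t ^ (CARD('d) * (k + 1))) * emeasure (m k) (D s k 1 :: (nat \<Rightarrow> real ^ 'd) set)"
proof (cases "t = 0")
  case True
  \<comment> \<open>The dilation degenerates at time 0, but both sides vanish because the exponent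
    is positive.\<close>
  then show ?thesis using D_zero[OF assms(1), of s, where 'd = 'd] by (simp add: zero_power)
next
  case False
  with assms have t: "t > 0" by simp
  let ?m = "m k :: (nat \<Rightarrow> real ^ 'd) measure"
  let ?T = "\<lambda>y. \<lambda>i\<in>{..<k+1}. t *\<^sub>R y i :: real ^ 'd"
  have T: "?T \<in> measurable ?m ?m"
    unfolding m_def by (intro measurable_restrict) simp
  have vimage: "?T -` D s k t \<inter> space ?m = D s k 1"
    using scaleR_mem_D_iff[OF t, of _ k s] by (auto simp: D_def)
  have "?m = scale_measure (ennreal (t ^ (CARD('d) * (k + 1)))) (distr ?m ?m ?T)"
    using PiM_lborel_scaleR[of "{..<k+1}" t, where 'a = "real ^ 'd"] t by (simp add: m_def)
  then have "emeasure ?m (D s k t) =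
      emeasure (scale_measure (ennreal (t ^ (CARD('d) * (k + 1)))) (distr ?m ?m ?T)) (D s k t)"
    by simp
  also have "\<dots> = ennreal (t ^ (CARD('d) * (k + 1))) * emeasure ?m (D s k 1)"
    using emeasure_distr[OF T sets_D] vimage by simp
  finally show ?thesis .
qed

text \<open>Up to the factor \<open>C f k\<close>, this is the mean of an increment of
  \<open>V\<close>. Finiteness of the larger set permits the subtraction.\<close>

lemma measure_D_diff:
  assumes k: "1 \<le> k" and "0 \<le> t" "t \<le> u"
  shows "measure (m k) (D s k u - D s k t :: (nat \<Rightarrow> real ^ 'd) set) =
    measure (m k) (D s k 1 :: (nat \<Rightarrow> real ^ 'd) set) *
      (u ^ (CARD('d) * (k + 1)) - t ^ (CARD('d) * (k + 1)))"
proof -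
  have scale: "measure (m k) (D s k v :: (nat \<Rightarrow> real ^ 'd) set) =
      v ^ (CARD('d) * (k + 1)) * measure (m k) (D s k 1 :: (nat \<Rightarrow> real ^ 'd) set)"
    if "0 \<le> v" for v
    using emeasure_D[OF k that, of s, where 'd = 'd] that by (simp add: measure_def enn2real_mult)
  have "measure (m k) (D s k u - D s k t :: (nat \<Rightarrow> real ^ 'd) set) =
      measure (m k) (D s k u :: (nat \<Rightarrow> real ^ 'd) set) - measure (m k) (D s k t :: (nat \<Rightarrow> real ^ 'd) set)"
    using emeasure_D_finite[OF k, of s u, where 'd = 'd]
    by (intro measure_Diff[OF _ sets_D sets_D D_mono[OF assms(3)]]) auto
  then show ?thesis
    using scale[of t] scale[of u] assms by (simp add: right_diff_distrib mult.commute)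
qed

lemma V_eq_emeasure:
  assumes "sets (M \<omega>) = sets (m k)"
  shows "V s k M t \<omega> = emeasure (M \<omega>) (D s k t)"
proof -
  have "V s k M t \<omega> = (\<integral>\<^sup>+y. indicator (D s k t) y \<partial>M \<omega>)"
    unfolding V_def using sets_eq_imp_space_eq[OF assms]
    by (intro nn_integral_cong) (auto simp: D_eq h_eq indicator_def)
  also have "\<dots> = emeasure (M \<omega>) (D s k t)"
    using sets_D[of s k t] assms by (intro nn_integral_indicator) simp
  finally show ?thesis .
qed

section \<open>Finite-dimensional distributions\<close>

text \<open>Disjoint layers are added and no masses subtracted, so the identity also covers infinite
  values.\<close>

lemma emeasure_incseq_eq_sum:
  fixes E :: "nat \<Rightarrow> 'a set"
  assumes "\<And>i. E i \<in> sets \<mu>" and "incseq E" and "E 0 = {}"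
  shows "emeasure \<mu> (E n) = (\<Sum>i<n. emeasure \<mu> (E (Suc i) - E i))"
proof (induction n)
  case (Suc n)
  have "emeasure \<mu> (E n \<union> (E (Suc n) - E n)) = emeasure \<mu> (E n) + emeasure \<mu> (E (Suc n) - E n)"
    using assms(1) by (intro plus_emeasure[symmetric]) auto
  moreover have "E n \<union> (E (Suc n) - E n) = E (Suc n)"
    using incseq_SucD[OF assms(2)] by blast
  ultimately show ?case using Suc by simp
qed (simp add: assms)

text \<open>Monotonicity makes each truncated difference a genuine one, so the sum
  telescopes.\<close>

lemma nat_eq_sum_increments:
  fixes a :: "nat \<Rightarrow> nat"
  assumes "mono a" and "a 0 = 0"
  shows "a n = (\<Sum>i<n. a (Suc i) - a i)"
proof (induction n)
  case (Suc n)
  then show ?case using monoD[OF assms(1), of n "Suc n"] by simp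
qed (simp add: assms)

theorem proposition5p1:
  fixes f :: "real ^ 'd \<Rightarrow> real"
    and k :: nat
    and s :: sign
    and P :: "'w measure"
    and M :: "'w \<Rightarrow> (nat \<Rightarrow> real ^ 'd) measure"
    and Q :: "'v measure"
    and N :: "real \<Rightarrow> 'v \<Rightarrow> nat"
  assumes "2 \<le> CARD('d)" and "1 \<le> k" and "k < CARD('d)"
    and "f \<in> borel_measurable borel" and "\<And>x. 0 \<le> f x"
    and "prob_space (density lborel (\<lambda>x. ennreal (f x)))"
    and "\<exists>B. AE x in lborel. f x \<le> B"
    and "AE x in lborel. isCont f x"
    and "poisson_random_measure P (scale_measure (ennreal (C f k)) (m k)) M"
    and "homogeneous_poisson_process Q (C f k * measure (m k) (D s k 1 :: (nat \<Rightarrow> real ^ 'd) set)) N"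
  shows "equal_fdd {0..} borel
           P (\<lambda>t. V s k M t)
           Q (\<lambda>t \<omega>. of_nat (N (t ^ (CARD('d) * (k + 1))) \<omega>))"
proof -
  let ?p = "CARD('d) * (k + 1)"
  let ?\<mu> = "scale_measure (ennreal (C f k)) (m k :: (nat \<Rightarrow> real ^ 'd) measure)"
  define r where "r = C f k * measure (m k) (D s k 1 :: (nat \<Rightarrow> real ^ 'd) set)"
  \<comment> \<open>This prevents \<open>ennreal (C f k)\<close> from being truncated to 0 when the
    mean measure is evaluated as a real number.\<close>
  have C: "0 \<le> C f k"
    unfolding C_def using assms(5) by (intro mult_nonneg_nonneg integral_nonneg_AE) auto
  note k = \<open>1 \<le> k\<close>
  note M = assms(9)[unfolded poisson_random_measure_def]
  note N = assms(10)[unfolded homogeneous_poisson_process_def, folded r_def]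
  have P: "prob_space P" and Q: "prob_space Q"
    using M N by blast+
  have sets_M: "sets (M \<omega>) = sets (m k)" if "\<omega> \<in> space P" for \<omega>
    using M that by simp
  have meas_M: "(\<lambda>\<omega>. emeasure (M \<omega>) A) \<in> borel_measurable P" if "A \<in> sets (m k)" for A
    using M that by simp
  have V: "V s k M t \<omega> = emeasure (M \<omega>) (D s k t)" if "\<omega> \<in> space P" for t \<omega>
    using sets_M[OF that] by (rule V_eq_emeasure)
  have meas_V: "V s k M t \<in> borel_measurable P" for t
    using meas_M[OF sets_D] V by (simp cong: measurable_cong)
  have meas_N: "N t \<in> measurable Q (count_space UNIV)" if "0 \<le> t" for t
    using N that by blast
  have meas_W: "(\<lambda>\<omega>. of_nat (N (t ^ ?p) \<omega>) :: ennreal) \<in> borel_measurable Q" if "0 \<le> t" for t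
    using meas_N[of "t ^ ?p"] that by simp
  have fdd: "distr P (PiM J (\<lambda>_. borel)) (\<lambda>\<omega>. \<lambda>t\<in>J. V s k M t \<omega>) =
      distr Q (PiM J (\<lambda>_. borel)) (\<lambda>\<omega>. \<lambda>t\<in>J. of_nat (N (t ^ ?p) \<omega>))"
    if J: "J \<subseteq> {0..}" "finite J" for J
  proof -
    obtain n and \<sigma> :: "nat \<Rightarrow> real" where n: "n > 0" and \<sigma>: "\<sigma> 0 = 0" "mono \<sigma>" "J \<subseteq> \<sigma> ` {..n}"
      by (rule finite_subset_range_mono[OF J(2), of 0]) (use J(1) in auto)
    have \<sigma>_nonneg: "0 \<le> \<sigma> i" for i using monoD[OF \<sigma>(2), of 0 i] \<sigma>(1) by simp
    have \<sigma>_Suc: "\<sigma> i \<le> \<sigma> (Suc i)" for i using monoD[OF \<sigma>(2)] by simp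
    have "\<forall>t\<in>J. \<exists>i. i \<le> n \<and> \<sigma> i = t" using \<sigma>(3) by blast
    \<comment> \<open>\<open>ix t\<close> is a position of the time \<open>t\<close> in the
      sequence, hence the number of increments to be summed. If values repeat, any choice
      works.\<close>
    then obtain ix where ix: "\<And>t. t \<in> J \<Longrightarrow> ix t \<le> n" "\<And>t. t \<in> J \<Longrightarrow> \<sigma> (ix t) = t"
      by metis
    define \<tau> where "\<tau> i = \<sigma> i ^ ?p" for i
    have \<tau>: "\<tau> 0 = 0" "mono \<tau>" "0 \<le> \<tau> i" for i
      using \<sigma>(1) monoD[OF \<sigma>(2)] \<sigma>_nonneg by (simp_all add: \<tau>_def mono_def power_mono)
    define E where "E i = (D s k (\<sigma> i) :: (nat \<Rightarrow> real ^ 'd) set)" for i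
    have E: "E i \<in> sets (m k)" "incseq E" "E 0 = {}" for i
      using sets_D D_zero[OF k] \<sigma>(1) monoD[OF \<sigma>(2)] by (simp_all add: E_def incseq_def D_mono)
    define X where "X i \<omega> = emeasure (M \<omega>) (E (Suc i) - E i)" for i \<omega>
    define Y where "Y i \<omega> = (of_nat (N (\<tau> (Suc i)) \<omega> - N (\<tau> i) \<omega>) :: ennreal)" for i \<omega>
    have meas_X: "X i \<in> borel_measurable P" for i
      unfolding X_def using E(1) by (intro meas_M) auto
    have meas_dN: "(\<lambda>\<omega>. N (\<tau> (Suc i)) \<omega> - N (\<tau> i) \<omega>) \<in> measurable Q (count_space UNIV)" for i
      using meas_N[OF \<tau>(3)[of i]] meas_N[OF \<tau>(3)[of "Suc i"]] by measurable
    have meas_Y: "Y i \<in> borel_measurable Q" for i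
      unfolding Y_def using meas_dN[of i] by simp
    have law: "distr P borel (X i) = distr Q borel (Y i)" for i
    proof -
      have "emeasure (m k) (E (Suc i) - E i) \<le> emeasure (m k) (E (Suc i))"
        using E(1) by (intro emeasure_mono) auto
      then have "emeasure (m k) (E (Suc i) - E i) < \<infinity>"
        using emeasure_D_finite[OF k, of s "\<sigma> (Suc i)", where 'd = 'd] by (simp add: E_def)
      then have "emeasure ?\<mu> (E (Suc i) - E i) < \<infinity>"
        by (simp add: ennreal_mult_less_top)
      \<comment> \<open>The mean mass of a layer equals the mean of the Poisson process increment
        over the corresponding interval of the changed time \<tau>.\<close>
      moreover have "measure ?\<mu> (E (Suc i) - E i) = r * (\<tau> (Suc i) - \<tau> i)"
        using C measure_D_diff[OF k \<sigma>_nonneg \<sigma>_Suc, of s i, where 'd = 'd]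
        by (simp add: E_def r_def \<tau>_def)
      moreover have "E (Suc i) - E i \<in> sets ?\<mu>" using E(1) by auto
      ultimately have "distr P borel (X i) =
          distr (measure_pmf (poisson_law (r * (\<tau> (Suc i) - \<tau> i)))) borel of_nat"
        using M unfolding X_def by metis
      also have "measure_pmf (poisson_law (r * (\<tau> (Suc i) - \<tau> i))) =
          distr Q (count_space UNIV) (\<lambda>\<omega>. N (\<tau> (Suc i)) \<omega> - N (\<tau> i) \<omega>)"
        using N \<tau>(3) monoD[OF \<tau>(2), of i "Suc i"] by simp
      \<comment> \<open>The counts are pushed forward to \<open>ennreal\<close>, where
        \<open>V\<close> takes its values.\<close>
      also have "distr \<dots> borel of_nat = distr Q borel (Y i)"
        using meas_dN by (simp add: distr_distr Y_def[abs_def] comp_def)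
      finally show ?thesis .
    qed
    have "disjoint_family_on (\<lambda>i. E (Suc i) - E i) {..<n}"
      using disjoint_family_on_mono[OF subset_UNIV disjoint_family_Suc[of E, OF incseq_SucD[OF E(2)]]] .
    moreover have "(\<lambda>i. E (Suc i) - E i) ` {..<n} \<subseteq> sets ?\<mu>" using E(1) by auto
    ultimately have indep_X: "prob_space.indep_vars P (\<lambda>_. borel) X {..<n}"
      using M unfolding X_def by blast
    have "prob_space.indep_vars Q (\<lambda>_. count_space UNIV) (\<lambda>i \<omega>. N (\<tau> (Suc i)) \<omega> - N (\<tau> i) \<omega>) {..<n}"
      using N \<tau>(3) monoD[OF \<tau>(2)] by simp
    then have indep_Y: "prob_space.indep_vars Q (\<lambda>_. borel) Y {..<n}"
      unfolding Y_def by (rule prob_space.indep_vars_compose2[OF Q, where Y = "\<lambda>_. of_nat"]) simp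
    have sum_X: "AE \<omega> in P. \<forall>t\<in>J. V s k M t \<omega> = (\<Sum>i<ix t. X i \<omega>)"
    \<comment> \<open>On this side the identity holds at every sample point, because
      \<open>M \<omega>\<close> is a measure there.\<close>
    proof (rule AE_I2, rule ballI)
      fix \<omega> t assume \<omega>: "\<omega> \<in> space P" and t: "t \<in> J"
      have "V s k M t \<omega> = emeasure (M \<omega>) (E (ix t))"
        unfolding V[OF \<omega>] E_def ix(2)[OF t] ..
      also have "\<dots> = (\<Sum>i<ix t. X i \<omega>)"
        unfolding X_def using E(1) sets_M[OF \<omega>]
        by (intro emeasure_incseq_eq_sum[OF _ E(2,3)]) simp
      finally show "V s k M t \<omega> = (\<Sum>i<ix t. X i \<omega>)" .
    qed
    have sum_Y: "AE \<omega> in Q. \<forall>t\<in>J. of_nat (N (t ^ ?p) \<omega>) = (\<Sum>i<ix t. Y i \<omega>)"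
      \<comment> \<open>The selected conjunct states that almost every path starts at 0 and is
        nondecreasing, which is what the telescoping needs.\<close>
      using N[THEN conjunct2, THEN conjunct2, THEN conjunct1]
    proof eventually_elim
      case (elim \<omega>)
      have "mono (\<lambda>i. N (\<tau> i) \<omega>)"
        using elim \<tau>(3) monoD[OF \<tau>(2)] by (simp add: mono_def mono_on_def)
      then have "N (\<tau> j) \<omega> = (\<Sum>i<j. N (\<tau> (Suc i)) \<omega> - N (\<tau> i) \<omega>)" for j
        using elim \<tau>(1) by (intro nat_eq_sum_increments) auto
      then have "of_nat (N (\<tau> j) \<omega>) = (\<Sum>i<j. Y i \<omega>)" for j
        unfolding Y_def of_nat_sum[symmetric] by (rule arg_cong)
      then show ?case using ix(2) unfolding \<tau>_def by metis
    qed
    have "distr P (PiM J (\<lambda>_. borel)) (\<lambda>\<omega>. \<lambda>t\<in>J. V s k M t \<omega>) =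
      distr (distr P (PiM {..<n} (\<lambda>_. borel)) (\<lambda>\<omega>. \<lambda>i\<in>{..<n}. X i \<omega>)) (PiM J (\<lambda>_. borel))
        (\<lambda>x. \<lambda>t\<in>J. \<Sum>i<ix t. x i)"
      by (rule distr_partial_sums[OF meas_X meas_V ix(1) sum_X])
    also have "distr P (PiM {..<n} (\<lambda>_. borel)) (\<lambda>\<omega>. \<lambda>i\<in>{..<n}. X i \<omega>) =
        distr Q (PiM {..<n} (\<lambda>_. borel)) (\<lambda>\<omega>. \<lambda>i\<in>{..<n}. Y i \<omega>)"
      \<comment> \<open>Positivity of \<open>n\<close> supplies the nonempty index set, also when
        \<open>J\<close> is empty.\<close>
      using n by (intro distr_indep_vars_eq[OF P Q _ indep_X indep_Y law]) auto
    also have "distr \<dots> (PiM J (\<lambda>_. borel)) (\<lambda>x. \<lambda>t\<in>J. \<Sum>i<ix t. x i) =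
        distr Q (PiM J (\<lambda>_. borel)) (\<lambda>\<omega>. \<lambda>t\<in>J. of_nat (N (t ^ ?p) \<omega>))"
      \<comment> \<open>The same map and the same \<open>ix\<close> now recover the time-changed
        process from its increments.\<close>
      using J(1) by (intro distr_partial_sums[OF meas_Y meas_W ix(1) sum_Y, symmetric]) auto
    finally show ?thesis .
  qed
  show ?thesis
    unfolding equal_fdd_def using meas_V meas_W fdd by simp
qed

end
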